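(* Let $u\in C([0,T];W^{1,\infty}_0(\Omega))$, let $C_0\in[0,1)$ be fixed and let $\nu_M\ge 0$. Let the set of nodal points $\{P_i^n:\ i=1,\dots,N_p,\ n=0,\dots,N_T\}$ be given by the following method: the initial points satisfy $a=P_1^0<P_2^0<\dots<P_{N_p}^0=b$, and for every $n=1,\dots,N_T$ $$\frac{P^{n}_i-P^{n-1}_i}{\Delta t}=u(P^{n-1}_i,t^{n-1})+\nu_M\,\frac{P^{n}_{i+1}-2P^{n}_i+P^{n}_{i-1}}{(P^{n-1}_i-P^{n-1}_{i-1})(P^{n-1}_{i+1}-P^{n-1}_i)},\qquad i=2,\dots,N_p-1,$$ $$P_1^n=a,\qquad P_{N_p}^n=b.$$ If $$\Delta t\,|u|_{C^0(W^{1,\infty}(\Omega))}\le C_0,$$ then the set of nodal points describes a moving mesh of $\Omega\times[0,T]$, i.e. for any $n\in\{0,\dots,N_T\}$ $$P_i^n<P_j^n\qquad\text{for all } i,j\in\{1,\dots,N_p\}\text{ with } i<j.$$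
   Context: $\Omega=(a,b)$ is a bounded interval in $\mathbb{R}$, $T>0$, $\Delta t>0$ is the time increment, $t^n=n\Delta t$, $N_T=\lfloor T/\Delta t\rfloor$, and $N_p\in\mathbb{N}$ is the number of mesh points. $W^{1,\infty}_0(\Omega)$ is the space of $W^{1,\infty}(\Omega)$ functions vanishing at $a$ and $b$, and $|u|_{C^0(W^{1,\infty}(\Omega))}=\sup_{t\in[0,T]}\|\partial_x u(\cdot,t)\|_{L^\infty(\Omega)}$. A moving mesh of $\Omega\times[0,T]$ (for the given time partition) is a set of points $\{P_i^n:\ i=1,\dots,N_p,\ n=0,\dots,N_T\}\subset\bar\Omega$ satisfying $a=P_1^n<P_2^n<\dots<P_{N_p}^n=b$ for all $n\in\{0,\dots,N_T\}$. The parameter $\nu_M$ is a regularization parameter of the mesh movement. *)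

theory Defs
  imports "HOL-Probability.Essential_Supremum"
begin

definition Linf_norm :: "real \<Rightarrow> real \<Rightarrow> (real \<Rightarrow> real) \<Rightarrow> ereal" where
  "Linf_norm a b f = esssup (lebesgue_on {a<..<b}) (\<lambda>x. ereal \<bar>f x\<bar>)"

definition Linf :: "real \<Rightarrow> real \<Rightarrow> (real \<Rightarrow> real) set" where
  "Linf a b = {f \<in> borel_measurable (lebesgue_on {a<..<b}). Linf_norm a b f < \<infinity>}"

text \<open>The space of smooth functions with compact support in the open interval, extended by zero.\<close>

definition test_functions :: "real \<Rightarrow> real \<Rightarrow> (real \<Rightarrow> real) set" where
  "test_functions a b =
     {\<phi>. (\<forall>k x. (deriv ^^ k) \<phi> differentiable (at x)) \<and>
         compact (closure {x. \<phi> x \<noteq> 0}) \<and> closure {x. \<phi> x \<noteq> 0} \<subseteq> {a<..<b}}"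

definition is_weak_deriv :: "real \<Rightarrow> real \<Rightarrow> (real \<Rightarrow> real) \<Rightarrow> (real \<Rightarrow> real) \<Rightarrow> bool" where
  "is_weak_deriv a b f g \<longleftrightarrow>
     (\<forall>\<phi> \<in> test_functions a b.
        (LINT x|lebesgue_on {a<..<b}. f x * deriv \<phi> x) =
        - (LINT x|lebesgue_on {a<..<b}. g x * \<phi> x))"

definition W1inf :: "real \<Rightarrow> real \<Rightarrow> (real \<Rightarrow> real) set" where
  "W1inf a b = {f \<in> Linf a b. \<exists>g \<in> Linf a b. is_weak_deriv a b f g}"

text \<open>Weak derivatives are unique only up to null sets; the choice of representative does not
  affect the norms below.\<close>

definition weak_deriv :: "real \<Rightarrow> real \<Rightarrow> (real \<Rightarrow> real) \<Rightarrow> real \<Rightarrow> real" where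
  "weak_deriv a b f = (SOME g. g \<in> Linf a b \<and> is_weak_deriv a b f g)"

definition W1inf_norm :: "real \<Rightarrow> real \<Rightarrow> (real \<Rightarrow> real) \<Rightarrow> ereal" where
  "W1inf_norm a b f = Linf_norm a b f + Linf_norm a b (weak_deriv a b f)"

text \<open>Elements of the Sobolev space are represented by their continuous representatives on the
  closed interval, so that boundary values and point values make sense. Values outside the closed
  interval are irrelevant.\<close>

definition W1inf_0 :: "real \<Rightarrow> real \<Rightarrow> (real \<Rightarrow> real) set" where
  "W1inf_0 a b = {f \<in> W1inf a b. continuous_on {a..b} f \<and> f a = 0 \<and> f b = 0}"

text \<open>Continuity in time is with respect to the norm of the Sobolev space.\<close>

definition C0_W1inf_0 :: "real \<Rightarrow> real \<Rightarrow> real \<Rightarrow> (real \<Rightarrow> real \<Rightarrow> real) set" where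
  "C0_W1inf_0 T a b =
     {u. (\<forall>t\<in>{0..T}. (\<lambda>x. u x t) \<in> W1inf_0 a b) \<and>
         (\<forall>t\<in>{0..T}. ((\<lambda>s. W1inf_norm a b (\<lambda>x. u x s - u x t)) \<longlongrightarrow> 0) (at t within {0..T}))}"

definition C0_W1inf_seminorm ::
    "real \<Rightarrow> real \<Rightarrow> real \<Rightarrow> (real \<Rightarrow> real \<Rightarrow> real) \<Rightarrow> ereal" where
  "C0_W1inf_seminorm T a b u = (SUP t\<in>{0..T}. Linf_norm a b (weak_deriv a b (\<lambda>x. u x t)))"

definition num_steps :: "real \<Rightarrow> real \<Rightarrow> nat" where
  "num_steps T \<Delta>t = nat \<lfloor>T / \<Delta>t\<rfloor>"

definition is_mesh :: "real \<Rightarrow> real \<Rightarrow> nat \<Rightarrow> (nat \<Rightarrow> real) \<Rightarrow> bool" where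
  "is_mesh a b N\<^sub>p p \<longleftrightarrow>
     p 1 = a \<and> p N\<^sub>p = b \<and> (\<forall>i\<in>{1..<N\<^sub>p}. p i < p (i + 1))"

text \<open>For families of nodal points, \<open>P n i\<close> is the \<open>i\<close>-th point at the \<open>n\<close>-th time level.\<close>

definition moving_mesh ::
    "real \<Rightarrow> real \<Rightarrow> real \<Rightarrow> real \<Rightarrow> nat \<Rightarrow> (nat \<Rightarrow> nat \<Rightarrow> real) \<Rightarrow> bool" where
  "moving_mesh a b T \<Delta>t N\<^sub>p P \<longleftrightarrow>
     (\<forall>n\<in>{0..num_steps T \<Delta>t}. (\<forall>i\<in>{1..N\<^sub>p}. P n i \<in> {a..b}) \<and> is_mesh a b N\<^sub>p (P n))"

text \<open>The points of level \<open>n\<close> are given implicitly by those of level \<open>n - 1\<close>.\<close>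

definition mesh_step ::
    "real \<Rightarrow> real \<Rightarrow> real \<Rightarrow> nat \<Rightarrow> real \<Rightarrow> (real \<Rightarrow> real \<Rightarrow> real) \<Rightarrow>
     (nat \<Rightarrow> nat \<Rightarrow> real) \<Rightarrow> nat \<Rightarrow> bool" where
  "mesh_step a b \<Delta>t N\<^sub>p \<nu>\<^sub>M u P n \<longleftrightarrow>
     (\<forall>i\<in>{2..N\<^sub>p - 1}.
        (P n i - P (n - 1) i) / \<Delta>t =
          u (P (n - 1) i) (real (n - 1) * \<Delta>t) +
          \<nu>\<^sub>M * ((P n (i + 1) - 2 * P n i + P n (i - 1)) /
                ((P (n - 1) i - P (n - 1) (i - 1)) * (P (n - 1) (i + 1) - P (n - 1) i)))) \<and>
     P n 1 = a \<and> P n N\<^sub>p = b"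

end

theory Submission
  imports Defs "HOL-Computational_Algebra.Polynomial"
begin

text \<open>An essentially bounded weak derivative makes the continuous representative Lipschitz, as one
  sees by testing with smoothed indicator functions of intervals. Hence
  \<open>\<Delta>t * |u| \<le> C\<^sub>0 < 1\<close> makes the explicit transport step \<open>x \<mapsto> x + \<Delta>t * u x t\<close> strictly
  increasing on \<open>[a, b]\<close>, and it fixes \<open>a\<close> and \<open>b\<close>. The implicit diffusion step preserves strict
  monotonicity by a discrete minimum principle for the increments of the nodal points.\<close>

subsection \<open>A smooth step function\<close>

text \<open>This is the regularity condition of \<open>test_functions\<close>, isolated from the
  condition on the support.\<close>

definition smooth :: "(real \<Rightarrow> real) \<Rightarrow> bool" where
  "smooth f \<longleftrightarrow> (\<forall>k x. (deriv ^^ k) f differentiable (at x))"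

text \<open>Derivatives are unique, so \<open>deriv\<close> of a member of \<open>S\<close> is again
  the member provided by closure; by induction all iterated derivatives stay in \<open>S\<close>.
  Smoothness proofs thus reduce to finding a family closed under differentiation.\<close>

lemma smooth_coinduct:
  assumes "f \<in> S"
    and S: "\<And>F. F \<in> S \<Longrightarrow> \<exists>F'\<in>S. \<forall>x. (F has_real_derivative F' x) (at x)"
  shows "smooth f"
proof -
  have "(deriv ^^ k) f \<in> S" for k
  proof (induction k)
    case (Suc k)
    obtain F' where F': "F' \<in> S" "\<forall>x. ((deriv ^^ k) f has_real_derivative F' x) (at x)"
      using S[OF Suc] by blast
    then have "deriv ((deriv ^^ k) f) = F'"
      by (auto intro!: DERIV_imp_deriv)
    with F' show ?case by simp
  qed (use assms in simp)
  then show ?thesis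
    unfolding smooth_def using S real_differentiable_def by blast
qed

lemma smooth_imp_DERIV: "smooth f \<Longrightarrow> (f has_real_derivative deriv f x) (at x)"
  unfolding smooth_def
  by (metis DERIV_imp_deriv funpow_0 real_differentiable_def)

lemma smooth_deriv: "smooth f \<Longrightarrow> smooth (deriv f)"
  unfolding smooth_def by (metis comp_apply funpow_Suc_right)

lemma smooth_primitive:
  assumes "\<And>x. (F has_real_derivative f x) (at x)" and "smooth f"
  shows "smooth F"
  by (rule smooth_coinduct[where S = "insert F {f. smooth f}"])
    (use assms in \<open>auto intro: smooth_imp_DERIV smooth_deriv\<close>)

lemma smooth_diff:
  assumes "smooth f" "smooth g"
  shows "smooth (\<lambda>x. f x - g x)"
proof (rule smooth_coinduct[where S = "{\<lambda>x. f x - g x |f g. smooth f \<and> smooth g}"])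
  fix F assume "F \<in> {\<lambda>x. f x - g x |f g. smooth f \<and> smooth g}"
  then obtain f g where "F = (\<lambda>x. f x - g x)" "smooth f" "smooth g" by blast
  then show "\<exists>F'\<in>{\<lambda>x. f x - g x |f g. smooth f \<and> smooth g}. \<forall>x. (F has_real_derivative F' x) (at x)"
    by (intro bexI[of _ "\<lambda>x. deriv f x - deriv g x"])
      (auto intro!: derivative_intros smooth_imp_DERIV smooth_deriv)
qed (use assms in blast)

lemma smooth_affine:
  assumes "smooth f"
  shows "smooth (\<lambda>x. f (c * x + d))"
\<comment> \<open>The factor \<open>r\<close> collects the powers of \<open>c\<close> that the chain
  rule produces.\<close>
proof (rule smooth_coinduct[where S = "{\<lambda>x. r * f (c * x + d) |r f. smooth f}"])
  fix F assume "F \<in> {\<lambda>x. r * f (c * x + d) |r f. smooth f}"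
  then obtain r f where F: "F = (\<lambda>x. r * f (c * x + d))" and f: "smooth f" by blast
  have "(F has_real_derivative (r * c) * deriv f (c * x + d)) (at x)" for x
    unfolding F
    by (auto intro!: derivative_eq_intros DERIV_chain2[OF smooth_imp_DERIV[OF f]])
  then show "\<exists>F'\<in>{\<lambda>x. r * f (c * x + d) |r f. smooth f}. \<forall>x. (F has_real_derivative F' x) (at x)"
    by (intro bexI[of _ "\<lambda>x. (r * c) * deriv f (c * x + d)"])
      (auto intro: smooth_deriv[OF f])
next
  show "(\<lambda>x. f (c * x + d)) \<in> {\<lambda>x. r * f (c * x + d) |r f. smooth f}"
    using assms by (intro CollectI exI[of _ 1] exI[of _ f]) auto
qed

text \<open>This family is closed under differentiation, which gives smoothness of
  \<^term>\<open>exp (- 1 / (x * (1 - x)))\<close>, the member with \<open>p = 1\<close> and \<open>m = 0\<close>.\<close>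

definition bump :: "real poly \<Rightarrow> nat \<Rightarrow> real \<Rightarrow> real" where
  "bump p m x = (if 0 < x \<and> x < 1
     then poly p x / (x * (1 - x)) ^ m * exp (- 1 / (x * (1 - x))) else 0)"

text \<open>The series of \<open>exp (1 / q)\<close> has nonnegative terms, so its
  \<open>n\<close>-th term alone is a lower bound; take reciprocals. The exponential thus beats any
  pole in \<open>q\<close>.\<close>

lemma exp_minus_inverse_le:
  fixes q :: real
  assumes "0 < q"
  shows "exp (- 1 / q) \<le> fact n * q ^ n"
proof -
  have "(\<Sum>k\<in>{n}. (1 / q) ^ k /\<^sub>R fact k) \<le> exp (1 / q)"
    unfolding sums_unique[OF exp_converges]
    using assms by (intro sum_le_suminf sums_summable[OF exp_converges]) auto
  with assms show ?thesis
    by (simp add: exp_minus field_simps)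
qed

text \<open>Quadratic decay towards every point outside the open unit interval forces the derivative
  there to be 0, in particular at the critical points 0 and 1.\<close>

lemma bump_quadratic_bound:
  obtains C where "\<And>x y. \<not> (0 < x \<and> x < 1) \<Longrightarrow> \<bar>bump p m y\<bar> \<le> C * (y - x)\<^sup>2"
proof -
  have "compact (poly p ` {0..1})"
    by (intro compact_continuous_image continuous_intros) auto
  then obtain B where B: "B > 0" "\<And>x. x \<in> {0..1} \<Longrightarrow> \<bar>poly p x\<bar> \<le> B"
    using compact_imp_bounded[THEN bounded_pos[THEN iffD1]] by (metis imageI real_norm_def)
  have "\<bar>bump p m y\<bar> \<le> (B * fact (m + 2)) * (y - x)\<^sup>2" if x: "\<not> (0 < x \<and> x < 1)" for x y
  proof (cases "0 < y \<and> y < 1")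
    case True
    define q where "q = y * (1 - y)"
    have q: "q > 0" using True by (simp add: q_def)
    have "\<bar>bump p m y\<bar> = \<bar>poly p y\<bar> / q ^ m * exp (- 1 / q)"
      using True q by (simp add: bump_def q_def[symmetric] abs_mult)
    \<comment> \<open>The exponent \<open>m + 2\<close> cancels the pole of order \<open>m\<close>
      and leaves two spare powers of \<open>q\<close>.\<close>
    also have "\<dots> \<le> B / q ^ m * (fact (m + 2) * q ^ (m + 2))"
      using q True B by (intro mult_mono divide_right_mono exp_minus_inverse_le) auto
    also have "\<dots> = (B * fact (m + 2)) * q\<^sup>2"
      using q by (simp add: power_add power2_eq_square field_simps)
    also have "q \<le> \<bar>y - x\<bar>"
    proof -
      \<comment> \<open>\<open>q\<close> is at most the distance from \<open>y\<close> to either end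
        point, and \<open>x\<close> lies at or beyond one of them.\<close>
      have "q \<le> y" "q \<le> 1 - y"
        using True unfolding q_def by (simp_all add: mult_left_le mult_left_le_one_le)
      then show ?thesis using x True by auto
    qed
    then have "(B * fact (m + 2)) * q\<^sup>2 \<le> (B * fact (m + 2)) * (y - x)\<^sup>2"
      using q B by (intro mult_left_mono) (auto simp: abs_le_square_iff[symmetric])
    finally show ?thesis .
  qed (use B in \<open>auto simp: bump_def\<close>)
  then show thesis using that by blast
qed

lemma DERIV_zero_if_quadratic_bound:
  fixes f :: "real \<Rightarrow> real"
  assumes "\<And>y. \<bar>f y\<bar> \<le> C * (y - x)\<^sup>2"
  shows "(f has_real_derivative 0) (at x)"
proof -
  have fx: "f x = 0" using assms[of x] by simp
  have "((\<lambda>y. (f y - f x) / (y - x)) \<longlongrightarrow> 0) (at x)"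
  proof (rule Lim_null_comparison)
    show "\<forall>\<^sub>F y in at x. norm ((f y - f x) / (y - x)) \<le> C * \<bar>y - x\<bar>"
      using assms by (auto simp: eventually_at_filter fx divide_le_eq power2_eq_square mult.assoc
         intro!: always_eventually)
    show "((\<lambda>y. C * \<bar>y - x\<bar>) \<longlongrightarrow> 0) (at x)"
      by (auto intro!: tendsto_eq_intros)
  qed
  then show ?thesis by (simp add: has_field_derivative_iff)
qed

text \<open>Write q for x * (1 - x), with coefficients \<open>[:0, 1, -1:]\<close> and derivative
  \<open>[:1, -2:]\<close>. Inside the unit interval the product rule, brought to the denominator
  q^(m + 2), has exactly this polynomial as numerator; elsewhere both sides are 0.\<close>

lemma DERIV_bump:
  "(bump p m has_real_derivative
     bump (pderiv p * [:0, 1, -1:]\<^sup>2 + ([:1:] - of_nat m * [:0, 1, -1:]) * [:1, -2:] * p) (m + 2) x) (at x)"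
  (is "(_ has_real_derivative bump ?r _ _) _")
proof (cases "0 < x \<and> x < 1")
  case True
  define q :: "real \<Rightarrow> real" where "q = (\<lambda>x. x * (1 - x))"
  have q: "q x > 0" using True by (simp add: q_def)
  have Dq: "(q has_real_derivative 1 - 2 * x) (at x)"
    unfolding q_def by (auto intro!: derivative_eq_intros)
  have Dm: "((\<lambda>x. 1 / q x ^ m) has_real_derivative - real m * (1 - 2 * x) / q x ^ (m + 1)) (at x)"
  proof (rule DERIV_cong)
    show "((\<lambda>x. 1 / q x ^ m) has_real_derivative
        - (real m * ((1 - 2 * x) * q x ^ (m - 1))) / (q x ^ m * q x ^ m)) (at x)"
      using q by (auto intro!: derivative_eq_intros Dq)
    show "- (real m * ((1 - 2 * x) * q x ^ (m - 1))) / (q x ^ m * q x ^ m) =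
        - real m * (1 - 2 * x) / q x ^ (m + 1)"
      \<comment> \<open>For \<open>m = 0\<close> the truncated exponent \<open>m - 1\<close> is
        harmless, since the factor \<open>real m\<close> vanishes.\<close>
      using q by (cases m) (auto simp: field_simps)
  qed
  have De: "((\<lambda>x. exp (- 1 / q x)) has_real_derivative (1 - 2 * x) / (q x)\<^sup>2 * exp (- 1 / q x)) (at x)"
    using q by (auto intro!: derivative_eq_intros Dq simp: field_simps power2_eq_square)
  have D: "((\<lambda>x. poly p x * (1 / q x ^ m) * exp (- 1 / q x)) has_real_derivative
      poly ?r x / q x ^ (m + 2) * exp (- 1 / q x)) (at x)"
  proof (rule DERIV_cong[OF DERIV_mult[OF DERIV_mult[OF poly_DERIV Dm] De]])
    have r: "poly ?r x = poly (pderiv p) x * (q x)\<^sup>2 + (1 - real m * q x) * (1 - 2 * x) * poly p x"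
      by (simp add: q_def power2_eq_square of_nat_poly algebra_simps)
    show "(poly (pderiv p) x * (1 / q x ^ m) + - real m * (1 - 2 * x) / q x ^ (m + 1) * poly p x) * exp (- 1 / q x) +
        (1 - 2 * x) / (q x)\<^sup>2 * exp (- 1 / q x) * (poly p x * (1 / q x ^ m)) =
        poly ?r x / q x ^ (m + 2) * exp (- 1 / q x)"
      unfolding r using q by (simp add: field_simps power2_eq_square)
  qed
  have ev: "\<forall>\<^sub>F y in nhds x. bump p m y = poly p y * (1 / q y ^ m) * exp (- 1 / q y)"
    using eventually_nhds_in_open[of "{0<..<1}" x] True
    by (auto elim!: eventually_mono simp: bump_def q_def)
  have "bump ?r (m + 2) x = poly ?r x / q x ^ (m + 2) * exp (- 1 / q x)"
    unfolding bump_def q_def using True by (rule if_P)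
  from iffD2[OF DERIV_cong_ev[OF refl ev this] D] show ?thesis .
next
  case False
  obtain C where "\<And>y. \<bar>bump p m y\<bar> \<le> C * (y - x)\<^sup>2"
    using bump_quadratic_bound False by metis
  then have "(bump p m has_real_derivative 0) (at x)"
    by (rule DERIV_zero_if_quadratic_bound)
  moreover have "bump ?r (m + 2) x = 0"
    unfolding bump_def using False by (rule if_not_P)
  ultimately show ?thesis by simp
qed

lemma smooth_bump: "smooth (bump p m)"
proof (rule smooth_coinduct[where S = "range (\<lambda>(p, m). bump p m)"])
  fix F assume "F \<in> range (\<lambda>(p, m). bump p m)"
  then obtain p m where F: "F = bump p m" by auto
  show "\<exists>F'\<in>range (\<lambda>(p, m). bump p m). \<forall>x. (F has_real_derivative F' x) (at x)"
    unfolding F by (rule bexI, rule allI, rule DERIV_bump) auto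
qed auto

text \<open>\<open>H\<close> is a primitive of a nonnegative bump. It is not normalised: its final
  value \<open>c\<close> is the mass of \<open>h\<close>, and it cancels later.\<close>

lemma smooth_step_exists:
  obtains H h :: "real \<Rightarrow> real" and c :: real
  where "smooth H" and "\<And>x. (H has_real_derivative h x) (at x)" and "continuous_on UNIV h"
    and "\<And>x. 0 \<le> h x" and "\<And>x. x \<notin> {0..1} \<Longrightarrow> h x = 0"
    and "\<And>x. x \<le> 0 \<Longrightarrow> H x = 0" and "\<And>x. 1 \<le> x \<Longrightarrow> H x = c" and "0 < c" and "mono H"
proof -
  define h where "h = bump 1 0"
  \<comment> \<open>Starting at -1 makes 0 an interior point of the range of integration, so the
    derivative at 0 is two-sided; the bump contributes nothing before 0.\<close>
  define H where "H x = integral {-1..x} h" for x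
  have h_nonneg: "0 \<le> h x" for x by (simp add: h_def bump_def)
  have h_0: "h x = 0" if "\<not> (0 < x \<and> x < 1)" for x using that by (auto simp add: h_def bump_def)
  have h_cont: "continuous_on A h" for A
    unfolding h_def using smooth_bump smooth_imp_DERIV
    by (meson DERIV_isCont continuous_at_imp_continuous_on)
  have H0: "H x = 0" if "x \<le> 0" for x
  proof -
    have "integral {-1..x} h = integral {-1..x} (\<lambda>_. 0)"
      by (intro integral_cong) (use that h_0 in auto)
    then show ?thesis by (simp add: H_def)
  qed
  have H_deriv: "(H has_real_derivative h x) (at x)" for x
  proof (cases "x < 0")
    case True
    then have "\<forall>\<^sub>F y in nhds x. H y = 0"
      using eventually_nhds_in_open[of "{..<0}" x] by (auto elim!: eventually_mono simp: H0)
    then have "(H has_real_derivative 0) (at x)"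
      by (subst DERIV_cong_ev[OF refl _ refl]) auto
    with True h_0 show ?thesis by simp
  next
    case False
    have "(H has_real_derivative h x) (at x within {-1..x + 1})"
      unfolding H_def by (intro integral_has_real_derivative h_cont) (use False in auto)
    moreover have "at x within {-1..x + 1} = at x"
      by (rule at_within_Icc_at) (use False in auto)
    ultimately show ?thesis by simp
  qed
  have mono: "mono H"
    by (rule monoI, rule DERIV_nonneg_imp_nondecreasing) (use H_deriv h_nonneg in auto)
  have H_cont: "continuous_on A H" for A
    by (meson H_deriv DERIV_isCont continuous_at_imp_continuous_on)
  have H1: "H x = H 1" if "1 \<le> x" for x
  proof (cases "x = 1")
    case False
    show ?thesis
    proof (rule DERIV_isconst_end[OF _ H_cont])
      show "(H has_real_derivative 0) (at y)" if "1 < y" for y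
        using H_deriv[of y] h_0[of y] that by simp
    qed (use that False in simp)
  qed simp
  have "H 0 < H 1"
  proof (rule DERIV_pos_imp_increasing_open[OF _ _ H_cont])
    show "\<exists>y. (H has_real_derivative y) (at x) \<and> 0 < y" if "0 < x" "x < 1" for x
      using H_deriv[of x] that by (auto simp: h_def bump_def)
  qed simp
  show thesis
  proof (rule that[of H h "H 1"])
    show "smooth H"
      using H_deriv by (rule smooth_primitive) (simp add: h_def smooth_bump)
    show "h x = 0" if "x \<notin> {0..1}" for x
      using that by (intro h_0) auto
    show "0 < H 1"
      using \<open>H 0 < H 1\<close> H0[of 0] by simp
  qed (fact H_deriv h_cont h_nonneg H0 H1 mono)+
qed

subsection \<open>Bounded weak derivatives and Lipschitz continuity\<close>

text \<open>The end points form a null set. This passes from the Lebesgue integrals of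
  \<open>is_weak_deriv\<close> to integrals to which the fundamental theorem of calculus
  applies.\<close>

lemma LINT_open_interval:
  fixes f :: "real \<Rightarrow> real"
  assumes "continuous_on {a..b} f"
  shows "(LINT x|lebesgue_on {a<..<b}. f x) = integral {a..b} f"
proof -
  have "integrable (lebesgue_on {a<..<b}) f"
    using set_integrable_subset[of lebesgue "{a..b}" f "{a<..<b}"]
      continuous_imp_integrable_real[OF assms]
    by (simp add: set_integrable_def integrable_restrict_space greaterThanLessThan_subseteq_atLeastAtMost_iff)
  then show ?thesis
    by (simp add: lebesgue_integral_eq_integral integral_open_interval_real)
qed

text \<open>The rescaled kernel is nonnegative, has mass \<open>c\<close> and lives on
  \<open>{z..z + d}\<close>, where \<open>f\<close> differs from \<open>f z\<close> by at most
  \<open>e\<close>. Replacing \<open>f\<close> by the constant \<open>f z\<close> under the integral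
  therefore costs at most \<open>c * e\<close>.\<close>

lemma mollifier_approx:
  fixes f h H :: "real \<Rightarrow> real"
  assumes H: "\<And>x. (H has_real_derivative h x) (at x)" and h: "continuous_on UNIV h"
    "\<And>x. 0 \<le> h x" "\<And>x. x \<notin> {0..1} \<Longrightarrow> h x = 0"
    and H_ends: "\<And>x. x \<le> 0 \<Longrightarrow> H x = 0" "\<And>x. 1 \<le> x \<Longrightarrow> H x = c"
    and z: "0 < d" "a \<le> z" "z + d \<le> b"
    and f: "continuous_on {a..b} f" "\<And>s. s \<in> {z..z + d} \<Longrightarrow> \<bar>f s - f z\<bar> \<le> e"
  shows "\<bar>integral {a..b} (\<lambda>s. f s * (h ((s - z) / d) / d)) - c * f z\<bar> \<le> c * e"
proof -
  define k where "k s = h ((s - z) / d) / d" for s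
  have k_cont: "continuous_on A k" for A
    unfolding k_def using z
    by (intro continuous_intros continuous_on_compose2[OF h(1)]) auto
  have "(k has_integral H ((b - z) / d) - H ((a - z) / d)) {a..b}"
  proof (rule fundamental_theorem_of_calculus)
    fix s
    have "((\<lambda>s. (s - z) / d) has_real_derivative 1 / d) (at s)"
      using z by (auto intro!: derivative_eq_intros)
    from DERIV_chain2[OF H this] have "((\<lambda>s. H ((s - z) / d)) has_real_derivative k s) (at s)"
      by (simp add: k_def)
    then show "((\<lambda>s. H ((s - z) / d)) has_vector_derivative k s) (at s within {a..b})"
      by (simp add: has_real_derivative_iff_has_vector_derivative has_vector_derivative_at_within)
  qed (use z in simp)
  \<comment> \<open>The window lies in \<open>{a..b}\<close>, so the two arguments of
    \<open>H\<close> are at most 0 and at least 1.\<close>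
  then have k: "(k has_integral c) {a..b}"
    using H_ends(1)[of "(a - z) / d"] H_ends(2)[of "(b - z) / d"] z by (simp add: divide_le_0_iff)
  have "integral {a..b} (\<lambda>s. f s * k s) - c * f z = integral {a..b} (\<lambda>s. f s * k s - f z * k s)"
    using integral_unique[OF k]
    by (subst Henstock_Kurzweil_Integration.integral_diff)
      (auto intro!: integrable_continuous_real continuous_intros f k_cont)
  also have "\<bar>\<dots>\<bar> \<le> integral {a..b} (\<lambda>s. e * k s)"
    unfolding real_norm_def[symmetric]
  proof (rule Henstock_Kurzweil_Integration.integral_norm_bound_integral)
    fix s assume "s \<in> {a..b}"
    show "norm (f s * k s - f z * k s) \<le> e * k s"
    proof (cases "s \<in> {z..z + d}")
      case True
      have "0 \<le> k s" unfolding k_def using h(2) z by simp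
      moreover have "norm (f s * k s - f z * k s) = \<bar>f s - f z\<bar> * \<bar>k s\<bar>"
        by (simp add: abs_mult flip: left_diff_distrib)
      ultimately show ?thesis
        using f(2)[OF True] by (simp add: mult_right_mono)
    next
      case False
      then have "(s - z) / d \<notin> {0..1}" using z by (auto simp: field_simps)
      then show ?thesis using h(3) by (simp add: k_def)
    qed
  qed (auto intro!: integrable_continuous_real continuous_intros f k_cont)
  also have "\<dots> = c * e"
    using integral_unique[OF k] by simp
  finally show ?thesis by (simp add: k_def)
qed

text \<open>The bound holds for all widths up to \<open>d0\<close>, so that windows at two different
  points can share one width.\<close>

lemma continuous_on_Icc_modulus:
  fixes f :: "real \<Rightarrow> real"
  assumes "continuous_on {a..b} f" "z \<in> {a..<b}" "0 < e"
  obtains d0 where "0 < d0" and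
    "\<And>d s. 0 < d \<Longrightarrow> d \<le> d0 \<Longrightarrow> z + d \<le> b \<and> (s \<in> {z..z + d} \<longrightarrow> \<bar>f s - f z\<bar> \<le> e)"
proof -
  obtain r where r: "0 < r" "\<And>s. s \<in> {a..b} \<Longrightarrow> dist s z < r \<Longrightarrow> dist (f s) (f z) < e"
    using assms unfolding continuous_on_iff by (metis atLeastAtMost_iff atLeastLessThan_iff less_imp_le)
  show thesis
  proof (rule that[of "min (r / 2) (b - z)"])
    fix d s assume d: "0 < d" "d \<le> min (r / 2) (b - z)"
    have "\<bar>f s - f z\<bar> \<le> e" if "s \<in> {z..z + d}"
      using r(2)[of s] that d assms(2) by (auto simp: dist_real_def)
    with d show "z + d \<le> b \<and> (s \<in> {z..z + d} \<longrightarrow> \<bar>f s - f z\<bar> \<le> e)" by auto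
  qed (use r assms in auto)
qed

lemma LINT_indicator_bound:
  fixes F :: "real \<Rightarrow> real"
  assumes "F \<in> borel_measurable (lebesgue_on {a<..<b})"
    and "AE s in lebesgue_on {a<..<b}. \<bar>F s\<bar> \<le> B * indicator {x..y} s"
    and "a < x" "x \<le> y" "y < b"
  shows "\<bar>LINT s|lebesgue_on {a<..<b}. F s\<bar> \<le> B * (y - x)"
proof -
  let ?M = "lebesgue_on {a<..<b}"
  have xy: "{x..y} \<in> sets ?M"
    using assms by (auto simp: sets_restrict_space_iff)
  have m: "emeasure ?M {x..y} = ennreal (y - x)"
    using assms by (subst emeasure_restrict_space) auto
  have Int: "{x..y} \<inter> {a<..<b} = {x..y}"
    using assms by auto
  have I: "integrable ?M (\<lambda>s. B * indicator {x..y} s)"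
    using xy m by (intro integrable_mult_right integrable_real_indicator) auto
  have "\<bar>LINT s|?M. F s\<bar> \<le> (LINT s|?M. \<bar>F s\<bar>)"
    using integral_norm_bound[of ?M F] by simp
  also have "\<dots> \<le> (LINT s|?M. B * indicator {x..y} s)"
  proof (rule integral_mono_AE)
    show "integrable ?M (\<lambda>s. \<bar>F s\<bar>)"
      by (rule Bochner_Integration.integrable_bound[OF I]) (use assms in auto)
  qed (use I assms in auto)
  also have "\<dots> = B * (y - x)"
    using xy m Int assms by (simp add: measure_def)
  finally show ?thesis .
qed

text \<open>The test function rises from 0 to \<open>c\<close> after \<open>x\<close> and falls back
  after \<open>y\<close>. Tested against its derivative, \<open>f\<close> gives nearly
  \<open>c * (f x - f y)\<close>; the other side of the weak identity is at most
  \<open>M * c\<close> times the length of the support. Then the smoothing width shrinks.\<close>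

lemma weak_deriv_bounded_imp_diff_le:
  fixes f g :: "real \<Rightarrow> real"
  assumes f: "continuous_on {a..b} f" and weak: "is_weak_deriv a b f g"
    and g: "g \<in> borel_measurable (lebesgue_on {a<..<b})"
      "AE s in lebesgue_on {a<..<b}. \<bar>g s\<bar> \<le> M"
    and "0 \<le> M" and xy: "a < x" "x < y" "y < b"
  shows "\<bar>f x - f y\<bar> \<le> M * (y - x)"
proof -
  obtain H h :: "real \<Rightarrow> real" and c where "smooth H"
    and H: "\<And>x. (H has_real_derivative h x) (at x)" and h: "continuous_on UNIV h"
      "\<And>x. 0 \<le> h x" "\<And>x. x \<notin> {0..1} \<Longrightarrow> h x = 0"
    and H_ends: "\<And>x. x \<le> 0 \<Longrightarrow> H x = 0" "\<And>x. 1 \<le> x \<Longrightarrow> H x = c" and "0 < c" "mono H"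
    using smooth_step_exists by metis
  have H_range: "0 \<le> H r \<and> H r \<le> c" for r
    using H_ends \<open>mono H\<close> by (metis monoD linear)
  \<comment> \<open>After division by \<open>c\<close>, each of the two mollifications costs
    \<open>e\<close>, and the excess length \<open>d \<le> e\<close> of the support costs
    \<open>M * e\<close>.\<close>
  have approx: "\<bar>f x - f y\<bar> \<le> M * (y - x) + (M + 2) * e" if e: "0 < e" for e
  proof -
    obtain d1 where d1: "0 < d1" "\<And>d s. 0 < d \<Longrightarrow> d \<le> d1 \<Longrightarrow>
        x + d \<le> b \<and> (s \<in> {x..x + d} \<longrightarrow> \<bar>f s - f x\<bar> \<le> e)"
      using continuous_on_Icc_modulus[OF f _ e, of x] xy by auto
    obtain d2 where d2: "0 < d2" "\<And>d s. 0 < d \<Longrightarrow> d \<le> d2 \<Longrightarrow>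
        y + d \<le> b \<and> (s \<in> {y..y + d} \<longrightarrow> \<bar>f s - f y\<bar> \<le> e)"
      using continuous_on_Icc_modulus[OF f _ e, of y] xy by auto
    \<comment> \<open>\<open>d1\<close> and \<open>d2\<close> control the oscillation of
      \<open>f\<close> near \<open>x\<close> and \<open>y\<close>, \<open>e\<close> bounds the
      excess length, and the last term keeps the support \<open>{x..y + d}\<close> inside the open
      interval.\<close>
    define d where "d = min (min d1 d2) (min e ((b - y) / 2))"
    have d: "0 < d" "d \<le> d1" "d \<le> d2" "d \<le> e"
      using d1(1) d2(1) e xy unfolding d_def by (auto simp: min_def)
    have "d \<le> (b - y) / 2"
      unfolding d_def by (rule min.coboundedI2[OF min.cobounded2])
    also have "\<dots> < b - y" using xy by simp
    finally have "y + d < b" by simp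
    note d = d this
    define k where "k z s = h ((s - z) / d) / d" for z s
    have k_cont: "continuous_on A (k z)" for A z
      unfolding k_def using d
      by (intro continuous_intros continuous_on_compose2[OF h(1)]) auto
    \<comment> \<open>a smoothed multiple of the indicator function of \<open>{x..y}\<close>\<close>
    define \<phi> where "\<phi> s = H ((s - x) / d) - H ((s - y) / d)" for s
    have H_deriv: "((\<lambda>s. H ((s - z) / d)) has_real_derivative k z s) (at s)" for z s
    proof -
      have "((\<lambda>s. (s - z) / d) has_real_derivative 1 / d) (at s)"
        using d by (auto intro!: derivative_eq_intros)
      from DERIV_chain2[OF H this] show ?thesis by (simp add: k_def)
    qed
    have \<phi>_deriv: "(\<phi> has_real_derivative k x s - k y s) (at s)" for s
      unfolding \<phi>_def by (intro DERIV_diff H_deriv)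
    \<comment> \<open>Left of \<open>x\<close> both steps are 0; right of \<open>y + d\<close> both
      equal \<open>c\<close> and cancel.\<close>
    have \<phi>_0: "\<phi> s = 0" if "s \<notin> {x..y + d}" for s
    proof (cases "s < x")
      case True
      then show ?thesis using d xy by (simp add: \<phi>_def H_ends divide_nonpos_pos)
    next
      case False
      then have "1 \<le> (s - x) / d" "1 \<le> (s - y) / d" using that d xy by auto
      then show ?thesis by (simp add: \<phi>_def H_ends)
    qed
    have \<phi>_le: "\<bar>\<phi> s\<bar> \<le> c" for s
      using H_range[of "(s - x) / d"] H_range[of "(s - y) / d"] by (auto simp: \<phi>_def)
    have "smooth \<phi>"
      using smooth_diff[OF smooth_affine[OF \<open>smooth H\<close>, of "1 / d" "- x / d"]
          smooth_affine[OF \<open>smooth H\<close>, of "1 / d" "- y / d"]]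
      by (simp add: \<phi>_def[abs_def] diff_divide_distrib)
    moreover have supp: "closure {s. \<phi> s \<noteq> 0} \<subseteq> {x..y + d}"
      by (rule closure_minimal) (use \<phi>_0 in blast, simp)
    moreover have "compact (closure {s. \<phi> s \<noteq> 0})"
      using supp by (meson bounded_subset bounded_closed_interval closed_closure compact_eq_bounded_closed)
    ultimately have "\<phi> \<in> test_functions a b"
      using d xy by (auto simp: test_functions_def smooth_def)
    then have "(LINT s|lebesgue_on {a<..<b}. f s * deriv \<phi> s) =
        - (LINT s|lebesgue_on {a<..<b}. g s * \<phi> s)"
      using weak by (simp add: is_weak_deriv_def)
    moreover have "deriv \<phi> s = k x s - k y s" for s
      using \<phi>_deriv by (rule DERIV_imp_deriv)
    ultimately have "(LINT s|lebesgue_on {a<..<b}. g s * \<phi> s) =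
        - (LINT s|lebesgue_on {a<..<b}. f s * (k x s - k y s))"
      by simp
    also have "(LINT s|lebesgue_on {a<..<b}. f s * (k x s - k y s)) =
        integral {a..b} (\<lambda>s. f s * (k x s - k y s))"
      by (intro LINT_open_interval continuous_intros f k_cont)
    also have "\<dots> = integral {a..b} (\<lambda>s. f s * k x s) - integral {a..b} (\<lambda>s. f s * k y s)"
      unfolding right_diff_distrib
      by (intro Henstock_Kurzweil_Integration.integral_diff integrable_continuous_real continuous_intros f k_cont)
    finally have parts: "(LINT s|lebesgue_on {a<..<b}. g s * \<phi> s) =
        - (integral {a..b} (\<lambda>s. f s * k x s) - integral {a..b} (\<lambda>s. f s * k y s))" .
    have fx: "\<bar>integral {a..b} (\<lambda>s. f s * k x s) - c * f x\<bar> \<le> c * e"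
      unfolding k_def
      by (rule mollifier_approx[OF H h H_ends]) (use d xy f d1(2)[of d] in auto)
    have fy: "\<bar>integral {a..b} (\<lambda>s. f s * k y s) - c * f y\<bar> \<le> c * e"
      unfolding k_def
      by (rule mollifier_approx[OF H h H_ends]) (use d xy f d2(2)[of d] in auto)
    have g\<phi>: "\<bar>LINT s|lebesgue_on {a<..<b}. g s * \<phi> s\<bar> \<le> (M * c) * (y + d - x)"
    proof (rule LINT_indicator_bound)
      have "continuous_on UNIV \<phi>"
        using \<phi>_deriv by (meson DERIV_isCont continuous_at_imp_continuous_on)
      then have "\<phi> \<in> borel_measurable (lebesgue_on {a<..<b})"
        by (intro continuous_imp_measurable_on_sets_lebesgue) (auto intro: continuous_on_subset)
      with g(1) show "(\<lambda>s. g s * \<phi> s) \<in> borel_measurable (lebesgue_on {a<..<b})"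
        by (rule borel_measurable_times)
      show "AE s in lebesgue_on {a<..<b}. \<bar>g s * \<phi> s\<bar> \<le> M * c * indicator {x..y + d} s"
        using g(2)
      proof eventually_elim
        case (elim s)
        then show ?case
          using \<phi>_0[of s] mult_mono[OF elim \<phi>_le[of s]] \<open>0 \<le> M\<close>
          by (cases "s \<in> {x..y + d}") (auto simp: abs_mult)
      qed
    qed (use d xy in auto)
    have "\<bar>c * f x - c * f y\<bar> \<le> M * c * (y + d - x) + 2 * (c * e)"
      using parts fx fy g\<phi> by linarith
    also have "M * c * (y + d - x) \<le> M * c * (y + e - x)"
      using d \<open>0 \<le> M\<close> \<open>0 < c\<close> by (intro mult_left_mono) auto
    also have "\<bar>c * f x - c * f y\<bar> = c * \<bar>f x - f y\<bar>"
      using \<open>0 < c\<close> by (simp add: abs_mult flip: right_diff_distrib)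
    finally have "c * \<bar>f x - f y\<bar> \<le> c * (M * (y - x) + (M + 2) * e)"
      by (simp add: algebra_simps)
    then show ?thesis using \<open>0 < c\<close> by simp
  qed
  show ?thesis
  proof (rule field_le_epsilon)
    fix e :: real assume "0 < e"
    then show "\<bar>f x - f y\<bar> \<le> M * (y - x) + e"
      using approx[of "e / (M + 2)"] \<open>0 \<le> M\<close> by simp
  qed
qed

text \<open>The estimate by test functions reaches interior points only; continuity of
  \<open>f\<close> carries it to the end points.\<close>

lemma weak_deriv_bounded_imp_lipschitz:
  fixes f g :: "real \<Rightarrow> real"
  assumes "a < b" and f: "continuous_on {a..b} f" and "is_weak_deriv a b f g"
    and "g \<in> borel_measurable (lebesgue_on {a<..<b})"
      "AE s in lebesgue_on {a<..<b}. \<bar>g s\<bar> \<le> M"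
    and "0 \<le> M"
  shows "M-lipschitz_on {a..b} f"
proof -
  have "M-lipschitz_on {a<..<b} f"
  proof (rule lipschitz_onI)
    fix x y assume "x \<in> {a<..<b}" "y \<in> {a<..<b}"
    then show "dist (f x) (f y) \<le> M * dist x y"
      using weak_deriv_bounded_imp_diff_le[OF f assms(3-6), of x y]
        weak_deriv_bounded_imp_diff_le[OF f assms(3-6), of y x]
      by (cases x y rule: linorder_cases) (auto simp: dist_real_def)
  qed fact
  then show ?thesis
    using lipschitz_on_closure[of M "{a<..<b}" f] f \<open>a < b\<close> by simp
qed

text \<open>Almost everywhere the chosen weak derivative at time \<open>t\<close> is bounded by its
  essential supremum, hence by the seminorm; the step size condition turns this into the bound
  \<open>C / \<Delta>t\<close>.\<close>

lemma C0_W1inf_0_lipschitz: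
  assumes "a < b" and u: "u \<in> C0_W1inf_0 T a b" and t: "t \<in> {0..T}"
    and "0 < \<Delta>t" "0 \<le> C"
    and C: "ereal \<Delta>t * C0_W1inf_seminorm T a b u \<le> ereal C"
  shows "(C / \<Delta>t)-lipschitz_on {a..b} (\<lambda>x. u x t)"
proof -
  let ?f = "\<lambda>x. u x t"
  let ?g = "weak_deriv a b ?f"
  have f: "?f \<in> W1inf a b" "continuous_on {a..b} ?f"
    using u t by (auto simp: C0_W1inf_0_def W1inf_0_def)
  then have "\<exists>g. g \<in> Linf a b \<and> is_weak_deriv a b ?f g"
    by (auto simp: W1inf_def)
  then have g: "?g \<in> Linf a b" "is_weak_deriv a b ?f ?g"
    unfolding weak_deriv_def by (metis (mono_tags, lifting) someI_ex)+
  have "AE s in lebesgue_on {a<..<b}. \<bar>?g s\<bar> \<le> C / \<Delta>t"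
    using esssup_AE[of "\<lambda>s. ereal \<bar>?g s\<bar>" "lebesgue_on {a<..<b}"]
  proof eventually_elim
    case (elim s)
    also have "esssup (lebesgue_on {a<..<b}) (\<lambda>s. ereal \<bar>?g s\<bar>) \<le> C0_W1inf_seminorm T a b u"
      using t by (auto simp: C0_W1inf_seminorm_def simp flip: Linf_norm_def intro: SUP_upper)
    finally have "ereal \<Delta>t * ereal \<bar>?g s\<bar> \<le> ereal \<Delta>t * C0_W1inf_seminorm T a b u"
      using \<open>0 < \<Delta>t\<close> by (intro ereal_mult_left_mono) auto
    also note C
    finally show ?case using \<open>0 < \<Delta>t\<close> by (simp add: field_simps)
  qed
  then show ?thesis
    using assms(1,4,5) f g by (intro weak_deriv_bounded_imp_lipschitz[where g = ?g]) (auto simp: Linf_def)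
qed

subsection \<open>One step of the mesh movement\<close>

text \<open>Discrete minimum principle: at an index where the increment of \<open>P\<close> is minimal, the implicit
  diffusion only increases it, so it is at least the corresponding increment of \<open>W\<close>.\<close>

lemma strict_mono_if_elliptic:
  fixes P W l :: "nat \<Rightarrow> real"
  assumes eq: "\<And>i. i \<in> {1..N} \<Longrightarrow> P i = W i + l i * (P (i + 1) - 2 * P i + P (i - 1))"
    and l: "\<And>i. i \<in> {1..N} \<Longrightarrow> 0 \<le> l i" "l 1 = 0" "l N = 0"
    and W: "\<And>i. i \<in> {1..<N} \<Longrightarrow> W i < W (i + 1)"
    and i: "i \<in> {1..<N}"
  shows "P i < P (i + 1)"
proof -
  define d where "d j = P (j + 1) - P j" for j
  obtain k where k: "k \<in> {1..<N}" and min: "\<And>j. j \<in> {1..<N} \<Longrightarrow> d k \<le> d j"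
    using ex_min_if_finite[of "d ` {1..<N}"] i
    by (metis (no_types, lifting) finite_atLeastLessThan finite_imageI image_iff
        image_is_empty linorder_not_le empty_iff)
  \<comment> \<open>For \<open>k = 1\<close> the increment \<open>d 0\<close> is not covered by
    minimality, and \<open>l 1 = 0\<close> removes it. At the right end \<open>l N = 0\<close> does
    the same.\<close>
  have left: "l k * (d k - d (k - 1)) \<le> 0"
  proof (cases "k = 1")
    case False
    then have "k - 1 \<in> {1..<N}" using k by auto
    from min[OF this] show ?thesis using k l(1)[of k] by (auto intro!: mult_nonneg_nonpos)
  qed (use l in simp)
  have right: "0 \<le> l (k + 1) * (d (k + 1) - d k)"
  proof (cases "k + 1 = N")
    case False
    then show ?thesis using k min[of "k + 1"] l(1)[of "k + 1"] by (auto intro!: mult_nonneg_nonneg)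
  qed (use l in simp)
  have "P k = W k + l k * (d k - d (k - 1))"
    using eq[of k] k by (auto simp: d_def algebra_simps)
  moreover have "P (k + 1) = W (k + 1) + l (k + 1) * (d (k + 1) - d k)"
    using eq[of "k + 1"] k by (auto simp: d_def algebra_simps)
  \<comment> \<open>Subtracting the two equations, \<open>d k\<close> is the increment of
    \<open>W\<close> plus the right term minus the left one, and neither diffusion term lowers
    it.\<close>
  ultimately have "0 < d k"
    using left right W[OF k] by (simp add: d_def)
  with min[OF i] show ?thesis by (simp add: d_def)
qed


section \<open>Order and range of mesh points, and their preservation by one step\<close>

lemma is_mesh_strict_mono:
  assumes "is_mesh a b N p" and "1 \<le> i" "i < j" "j \<le> N"
  shows "p i < p j"
proof -
  from \<open>i < j\<close> have "Suc i \<le> j" by simp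
  then show ?thesis using \<open>j \<le> N\<close>
  proof (induction j rule: dec_induct)
    case base
    then show ?case using assms by (auto simp: is_mesh_def)
  next
    case (step k)
    then have "p k < p (Suc k)" using assms by (auto simp: is_mesh_def)
    with step show ?case by simp
  qed
qed

lemma is_mesh_bounds:
  assumes "is_mesh a b N p" and "i \<in> {1..N}"
  shows "p i \<in> {a..b}"
proof -
  have "p 1 \<le> p i" "p i \<le> p N"
    using is_mesh_strict_mono[OF assms(1), of 1 i] is_mesh_strict_mono[OF assms(1), of i N] assms(2)
    by (cases "i = 1"; cases "i = N"; force)+
  then show ?thesis using assms(1) by (simp add: is_mesh_def)
qed

text \<open>The scheme splits into explicit transport to \<open>W\<close> and an implicit diffusion
  with weights \<open>l\<close>. Transport changes the gap between neighbours by at most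
  \<open>C\<close> times that gap, so \<open>C < 1\<close> keeps \<open>W\<close> increasing; the
  old mesh being ordered makes the weights nonnegative.\<close>

lemma mesh_step_is_mesh:
  assumes mesh: "is_mesh a b N (P (n - 1))"
    and step: "mesh_step a b \<Delta>t N \<nu> u P n"
    and "0 < \<Delta>t" "0 \<le> \<nu>" and C: "C < 1"
    and bc: "u a (real (n - 1) * \<Delta>t) = 0" "u b (real (n - 1) * \<Delta>t) = 0"
    and lip: "\<And>x y. x \<in> {a..b} \<Longrightarrow> y \<in> {a..b} \<Longrightarrow>
        \<Delta>t * \<bar>u x (real (n - 1) * \<Delta>t) - u y (real (n - 1) * \<Delta>t)\<bar> \<le> C * \<bar>x - y\<bar>"
  shows "is_mesh a b N (P n)"
proof -
  define Q where "Q = P (n - 1)"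
  define v where "v x = u x (real (n - 1) * \<Delta>t)" for x
  define W where "W i = Q i + \<Delta>t * v (Q i)" for i
  \<comment> \<open>\<open>l\<close> vanishes at the end points, so that the boundary conditions take the form of the interior equations\<close>
  define l where "l i = (if i = 1 \<or> i = N then 0 else
      \<Delta>t * \<nu> / ((Q i - Q (i - 1)) * (Q (i + 1) - Q i)))" for i
  have Q: "is_mesh a b N Q" using mesh by (simp add: Q_def)
  have Qlt: "Q i < Q (i + 1)" if "i \<in> {1..<N}" for i
    using Q that by (simp add: is_mesh_def)
  have "P n i < P n (i + 1)" if "i \<in> {1..<N}" for i
  proof (rule strict_mono_if_elliptic[where l = l and W = W and N = N])
    fix i assume i: "i \<in> {1..N}"
    show "P n i = W i + l i * (P n (i + 1) - 2 * P n i + P n (i - 1))"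
    proof (cases "i = 1 \<or> i = N")
      case True
      \<comment> \<open>As \<open>u\<close> vanishes at \<open>a\<close> and \<open>b\<close>,
        \<open>W\<close> fixes the end points, which are also prescribed for
        \<open>P n\<close>.\<close>
      then show ?thesis
        using step Q bc by (auto simp: mesh_step_def is_mesh_def W_def v_def l_def)
    next
      case False
      with i have "i \<in> {2..N - 1}" by auto
      with step have "(P n i - Q i) / \<Delta>t = v (Q i) +
          \<nu> * ((P n (i + 1) - 2 * P n i + P n (i - 1)) / ((Q i - Q (i - 1)) * (Q (i + 1) - Q i)))"
        unfolding mesh_step_def Q_def v_def by blast
      then have "P n i - Q i = \<Delta>t * (v (Q i) +
          \<nu> * ((P n (i + 1) - 2 * P n i + P n (i - 1)) / ((Q i - Q (i - 1)) * (Q (i + 1) - Q i))))"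
        using \<open>0 < \<Delta>t\<close> by (simp add: divide_eq_eq mult.commute)
      with False show ?thesis by (simp add: W_def l_def algebra_simps)
    qed
    show "0 \<le> l i"
    proof (cases "i = 1 \<or> i = N")
      case False
      then have "i \<in> {1..<N}" "i - 1 \<in> {1..<N}" "i - 1 + 1 = i" using i by auto
      then have "Q i < Q (i + 1)" "Q (i - 1) < Q i" using Qlt by metis+
      then show ?thesis
        using assms(3,4) by (auto simp: l_def)
    qed (auto simp: l_def)
  next
    fix i assume i: "i \<in> {1..<N}"
    have "\<Delta>t * \<bar>v (Q i) - v (Q (i + 1))\<bar> \<le> C * \<bar>Q i - Q (i + 1)\<bar>"
      unfolding v_def using i by (intro lip is_mesh_bounds[OF Q]) auto
    also have "\<dots> < \<bar>Q i - Q (i + 1)\<bar>" using Qlt[OF i] C by simp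
    finally have "\<bar>\<Delta>t * v (Q i) - \<Delta>t * v (Q (i + 1))\<bar> < Q (i + 1) - Q i"
      using Qlt[OF i] \<open>0 < \<Delta>t\<close> by (simp add: abs_mult flip: right_diff_distrib)
    then show "W i < W (i + 1)" by (simp add: W_def)
  qed (use that in \<open>auto simp: l_def\<close>)
  with step show ?thesis by (auto simp: is_mesh_def mesh_step_def)
qed

section \<open>Induction over the time levels\<close>

theorem theorem1:
  fixes a b T \<Delta>t C\<^sub>0 \<nu>\<^sub>M :: real
    and N\<^sub>p :: nat
    and u :: "real \<Rightarrow> real \<Rightarrow> real"
    and P :: "nat \<Rightarrow> nat \<Rightarrow> real"
  assumes "a < b" and "T > 0" and "\<Delta>t > 0"
    and "u \<in> C0_W1inf_0 T a b"
    and "0 \<le> C\<^sub>0" and "C\<^sub>0 < 1" and "\<nu>\<^sub>M \<ge> 0"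
    and "is_mesh a b N\<^sub>p (P 0)"
    and "\<forall>n\<in>{1..num_steps T \<Delta>t}. mesh_step a b \<Delta>t N\<^sub>p \<nu>\<^sub>M u P n"
    and "ereal \<Delta>t * C0_W1inf_seminorm T a b u \<le> ereal C\<^sub>0"
  shows "moving_mesh a b T \<Delta>t N\<^sub>p P \<and>
    (\<forall>n\<in>{0..num_steps T \<Delta>t}. \<forall>i\<in>{1..N\<^sub>p}. \<forall>j\<in>{1..N\<^sub>p}. i < j \<longrightarrow> P n i < P n j)"
proof -
  have mesh: "is_mesh a b N\<^sub>p (P n)" if "n \<le> num_steps T \<Delta>t" for n
    using that
  proof (induction n)
    case (Suc n)
    let ?t = "real n * \<Delta>t"
    \<comment> \<open>The step to level \<open>Suc n\<close> evaluates \<open>u\<close> at the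
      previous time, which must lie in \<open>{0..T}\<close> for the Lipschitz bound and the
      boundary values to be available.\<close>
    have "real n \<le> T / \<Delta>t"
      using Suc.prems \<open>T > 0\<close> \<open>\<Delta>t > 0\<close> unfolding num_steps_def
      by (metis Suc_leD of_nat_floor order_trans of_nat_le_iff divide_nonneg_pos less_imp_le)
    then have t: "?t \<in> {0..T}"
      using \<open>\<Delta>t > 0\<close> by (simp add: pos_le_divide_eq)
    have lip: "(C\<^sub>0 / \<Delta>t)-lipschitz_on {a..b} (\<lambda>x. u x ?t)"
      by (rule C0_W1inf_0_lipschitz[OF assms(1,4) t assms(3,5,10)])
    have bc: "u a ?t = 0" "u b ?t = 0"
      using assms(4) t by (auto simp: C0_W1inf_0_def W1inf_0_def)
    show ?case
    proof (rule mesh_step_is_mesh[where n = "Suc n" and u = u and \<nu> = \<nu>\<^sub>M and C = C\<^sub>0])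
      fix x y assume "x \<in> {a..b}" "y \<in> {a..b}"
      \<comment> \<open>Multiplication by \<open>\<Delta>t\<close> turns the Lipschitz constant
        \<open>C\<^sub>0 / \<Delta>t\<close> into \<open>C\<^sub>0\<close>.\<close>
      then show "\<Delta>t * \<bar>u x (real (Suc n - 1) * \<Delta>t) - u y (real (Suc n - 1) * \<Delta>t)\<bar> \<le> C\<^sub>0 * \<bar>x - y\<bar>"
        using lipschitz_onD[OF lip, of x y] \<open>\<Delta>t > 0\<close> by (simp add: dist_real_def field_simps)
    qed (use Suc assms bc in auto)
  qed (use assms in simp)
  then show ?thesis
    using is_mesh_bounds is_mesh_strict_mono unfolding moving_mesh_def by fastforce
qed

end
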